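(* Let $k \geqslant 2$ be a fixed integer. There exists $n_0 = n_0(k)$ such that for every integer $n \geqslant n_0$ and every positive integer $q$ the following hold for the $(1:q)$ Client--Waiter non--2--colourability game played on the edge set $E(K_n^{(k)})$ of the complete $k$--uniform hypergraph $K_n^{(k)}$ on $n$ vertices. (i) If $q \leqslant \binom{\lceil n/2\rceil}{k}\frac{\ln 2}{(1+\ln 2)n}$, then Client has a strategy to build a non--2--colourable hypergraph (that is, Client has a winning strategy). (ii) If $q \geqslant k^3 2^{-k+5}\binom{n}{k}/n$, then Waiter has a strategy ensuring that Client has a 2--colourable hypergraph at the end of the game (that is, Waiter has a winning strategy).
   Context: $K_n^{(k)}$ is the hypergraph on $n$ vertices whose edges are all $k$-element subsets of the vertex set. For a set $F\subseteq E(K_n^{(k)})$, the weak chromatic number $\chi(F)$ is the smallest integer $r$ such that $V(K_n^{(k)})$ can be partitioned into $r$ independent sets, where a set of vertices is independent if it contains no edge of $F$ entirely. The hypergraph with vertex set $V(K_n^{(k)})$ and edge set $F$ is 2--colourable if $\chi(F)\leqslant 2$, and non--2--colourable if $\chi(F)>2$. The $(1:q)$ Client--Waiter game $(X,\mathcal{F})$, where $X$ is a finite set (the board), $\mathcal{F}\subseteq 2^X$ is the family of winning sets and $q$ is a positive integer, is the following two--player perfect information game. At the beginning of each round, Waiter offers Client $t$ free (that is, previously unclaimed) elements of $X$, where Waiter chooses both the elements and the number $t$ with $1\leqslant t\leqslant q+1$. Client claims one of these, and the remaining offered elements (if any) are claimed by Waiter. The game ends when all elements of $X$ are claimed. Client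 wins if he has fully claimed some winning set in $\mathcal{F}$; otherwise Waiter wins. The non--2--colourability game has board $X=E(K_n^{(k)})$ and winning sets $\mathcal{NC}_2=\{F\subseteq E(K_n^{(k)}):\chi(F)>2\}$. Client's hypergraph is the hypergraph with vertex set $V(K_n^{(k)})$ whose edges are those claimed by Client. *)

theory Defs
  imports Complex_Main "HOL-Library.Disjoint_Sets"
begin

section \<open>Weak colourings of hypergraphs\<close>

definition complete_edges :: "nat \<Rightarrow> nat \<Rightarrow> nat set set" where
  "complete_edges k n = {e. e \<subseteq> {..<n} \<and> card e = k}"

definition independent :: "'v set set \<Rightarrow> 'v set \<Rightarrow> bool" where
  "independent F S \<longleftrightarrow> (\<forall>e\<in>F. \<not> e \<subseteq> S)"

text \<open>The least \<open>r\<close> below exists whenever \<open>V\<close> is finite and no edge has fewer than two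
  vertices, because the partition into singletons then qualifies.\<close>

definition weak_chromatic_number :: "'v set \<Rightarrow> 'v set set \<Rightarrow> nat" where
  "weak_chromatic_number V F =
     (LEAST r. \<exists>P. partition_on V P \<and> finite P \<and> card P = r \<and> (\<forall>S\<in>P. independent F S))"

definition NC2 :: "nat \<Rightarrow> nat \<Rightarrow> nat set set set" where
  "NC2 k n = {F. F \<subseteq> complete_edges k n \<and> weak_chromatic_number {..<n} F > 2}"


section \<open>Client--Waiter games\<close>

text \<open>A history is the list of rounds played so far, the earliest first. Each round consists of
  the set offered by Waiter and the element of it claimed by Client.\<close>

type_synonym 'a history = "('a set \<times> 'a) list"

definition claimed :: "'a history \<Rightarrow> 'a set" where
  "claimed h = (\<Union>(A, c)\<in>set h. A)"

definition client_claimed :: "'a history \<Rightarrow> 'a set" where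
  "client_claimed h = snd ` set h"

definition legal_offer :: "'a set \<Rightarrow> nat \<Rightarrow> 'a history \<Rightarrow> 'a set \<Rightarrow> bool" where
  "legal_offer X q h A \<longleftrightarrow> A \<subseteq> X - claimed h \<and> 1 \<le> card A \<and> card A \<le> q + 1"

inductive legal_history :: "'a set \<Rightarrow> nat \<Rightarrow> 'a history \<Rightarrow> bool" for X q where
  start: "legal_history X q []"
| round: "legal_history X q h \<Longrightarrow> legal_offer X q h A \<Longrightarrow> c \<in> A \<Longrightarrow> legal_history X q (h @ [(A, c)])"

definition complete_play :: "'a set \<Rightarrow> nat \<Rightarrow> 'a history \<Rightarrow> bool" where
  "complete_play X q h \<longleftrightarrow> legal_history X q h \<and> claimed h = X"

definition client_wins_play :: "'a set set \<Rightarrow> 'a history \<Rightarrow> bool" where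
  "client_wins_play \<F> h \<longleftrightarrow> (\<exists>W\<in>\<F>. W \<subseteq> client_claimed h)"

definition client_strategy :: "'a set \<Rightarrow> nat \<Rightarrow> ('a history \<Rightarrow> 'a set \<Rightarrow> 'a) \<Rightarrow> bool" where
  "client_strategy X q \<tau> \<longleftrightarrow>
     (\<forall>h A. legal_history X q h \<longrightarrow> legal_offer X q h A \<longrightarrow> \<tau> h A \<in> A)"

definition waiter_strategy :: "'a set \<Rightarrow> nat \<Rightarrow> ('a history \<Rightarrow> 'a set) \<Rightarrow> bool" where
  "waiter_strategy X q \<sigma> \<longleftrightarrow>
     (\<forall>h. legal_history X q h \<longrightarrow> claimed h \<noteq> X \<longrightarrow> legal_offer X q h (\<sigma> h))"

definition follows_client :: "('a history \<Rightarrow> 'a set \<Rightarrow> 'a) \<Rightarrow> 'a history \<Rightarrow> bool" where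
  "follows_client \<tau> h \<longleftrightarrow> (\<forall>i<length h. snd (h ! i) = \<tau> (take i h) (fst (h ! i)))"

definition follows_waiter :: "('a history \<Rightarrow> 'a set) \<Rightarrow> 'a history \<Rightarrow> bool" where
  "follows_waiter \<sigma> h \<longleftrightarrow> (\<forall>i<length h. fst (h ! i) = \<sigma> (take i h))"

definition client_has_winning_strategy :: "'a set \<Rightarrow> 'a set set \<Rightarrow> nat \<Rightarrow> bool" where
  "client_has_winning_strategy X \<F> q \<longleftrightarrow>
     (\<exists>\<tau>. client_strategy X q \<tau> \<and>
        (\<forall>h. complete_play X q h \<longrightarrow> follows_client \<tau> h \<longrightarrow> client_wins_play \<F> h))"

definition waiter_has_winning_strategy :: "'a set \<Rightarrow> 'a set set \<Rightarrow> nat \<Rightarrow> bool" where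
  "waiter_has_winning_strategy X \<F> q \<longleftrightarrow>
     (\<exists>\<sigma>. waiter_strategy X q \<sigma> \<and>
        (\<forall>h. complete_play X q h \<longrightarrow> follows_waiter \<sigma> h \<longrightarrow> \<not> client_wins_play \<F> h))"

end

theory Submission imports Defs begin

text \<open>(i) Client hits every \<open>K\<^sub>S = {e. e \<subseteq> S \<and> card e = k}\<close> with \<open>card S = \<lceil>n/2\<rceil>\<close>: choosing uniformly at random
  from each offer does not increase the expectation of the sum of \<open>(q/(q+1))\<^sup>u\<close> over the sets not yet hit,
  \<open>u\<close> being the number of unclaimed elements, so some choice keeps it below 1.

  (ii) Waiter gives the vertices \<open>2i\<close> and \<open>2i+1\<close> opposite colours, fixing them pair by pair. When pair
  \<open>i\<close> is due he offers at once all edges consisting of one vertex of the pair and a monochromatic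
  set of earlier vertices. Since the earlier colours are balanced there are at most
  \<open>4 (i choose (k - 1))\<close> of them, which fits into one offer. Client gets a single one of these, and the
  pair is coloured so that this one is not monochromatic.\<close>

section \<open>Strategies from invariants\<close>

lemma claimed_Nil [simp]: "claimed [] = {}"
  by (simp add: claimed_def)

lemma claimed_snoc [simp]: "claimed (h @ [(A, c)]) = claimed h \<union> A"
  by (auto simp: claimed_def)

lemma client_claimed_Nil [simp]: "client_claimed [] = {}"
  by (simp add: client_claimed_def)

lemma client_claimed_snoc [simp]: "client_claimed (h @ [(A, c)]) = insert c (client_claimed h)"
  by (auto simp: client_claimed_def)

lemma client_claimed_subset: "legal_history X q h \<Longrightarrow> client_claimed h \<subseteq> claimed h"
  by (induction rule: legal_history.induct) auto

lemma claimed_subset: "legal_history X q h \<Longrightarrow> claimed h \<subseteq> X"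
  by (induction rule: legal_history.induct) (auto simp: legal_offer_def)

lemma follows_client_snoc:
  "follows_client \<tau> (h @ [(A, c)]) \<longleftrightarrow> follows_client \<tau> h \<and> c = \<tau> h A"
  by (auto simp: follows_client_def nth_append less_Suc_eq)

lemma follows_waiter_snoc:
  "follows_waiter \<sigma> (h @ [(A, c)]) \<longleftrightarrow> follows_waiter \<sigma> h \<and> A = \<sigma> h"
  by (auto simp: follows_waiter_def nth_append less_Suc_eq)

lemma client_wins_by_invariant:
  assumes init: "I []"
    and step: "\<And>h A. \<lbrakk>legal_history X q h; I h; legal_offer X q h A\<rbrakk> \<Longrightarrow> \<exists>c\<in>A. I (h @ [(A, c)])"
    and final: "\<And>h. \<lbrakk>complete_play X q h; I h\<rbrakk> \<Longrightarrow> client_wins_play \<F> h"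
  shows "client_has_winning_strategy X \<F> q"
proof -
  \<comment> \<open>The guard \<open>I h\<close> keeps the choice satisfiable at histories where the
    invariant fails; \<open>client_strategy\<close> demands an element of the offer there
    too.\<close>
  define \<tau> where "\<tau> h A = (SOME c. c \<in> A \<and> (I h \<longrightarrow> I (h @ [(A, c)])))" for h A
  have \<tau>: "\<tau> h A \<in> A \<and> (I h \<longrightarrow> I (h @ [(A, \<tau> h A)]))"
    if "legal_history X q h" "legal_offer X q h A" for h A
  proof -
    have "A \<noteq> {}"
      using that by (auto simp: legal_offer_def)
    then have "\<exists>c. c \<in> A \<and> (I h \<longrightarrow> I (h @ [(A, c)]))"
      using step that by blast
    then show ?thesis
      unfolding \<tau>_def by (rule someI_ex)
  qed
  have inv: "follows_client \<tau> h \<longrightarrow> I h" if "legal_history X q h" for h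
    using that by induction (auto simp: init follows_client_snoc \<tau>)
  show ?thesis
    unfolding client_has_winning_strategy_def client_strategy_def
    using \<tau> inv final by (intro exI[of _ \<tau>]) (auto simp: complete_play_def)
qed

lemma waiter_wins_by_invariant:
  assumes init: "I []"
    and step: "\<And>h. \<lbrakk>legal_history X q h; I h; claimed h \<noteq> X\<rbrakk>
      \<Longrightarrow> \<exists>A. legal_offer X q h A \<and> (\<forall>c\<in>A. I (h @ [(A, c)]))"
    and final: "\<And>h. \<lbrakk>complete_play X q h; I h\<rbrakk> \<Longrightarrow> \<not> client_wins_play \<F> h"
  shows "waiter_has_winning_strategy X \<F> q"
proof -
  define \<sigma> where "\<sigma> h = (SOME A. legal_offer X q h A \<and> (I h \<longrightarrow> (\<forall>c\<in>A. I (h @ [(A, c)]))))" for h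
  have \<sigma>: "legal_offer X q h (\<sigma> h) \<and> (I h \<longrightarrow> (\<forall>c\<in>\<sigma> h. I (h @ [(\<sigma> h, c)])))"
    if h: "legal_history X q h" "claimed h \<noteq> X" for h
  proof -
    \<comment> \<open>Where the invariant fails, a single free element is the default legal
      offer.\<close>
    obtain x where "x \<in> X - claimed h"
      using claimed_subset h by blast
    then have "legal_offer X q h {x}"
      by (simp add: legal_offer_def)
    then have "\<exists>A. legal_offer X q h A \<and> (I h \<longrightarrow> (\<forall>c\<in>A. I (h @ [(A, c)])))"
      using step[OF h(1) _ h(2)] by blast
    then show ?thesis
      unfolding \<sigma>_def by (rule someI_ex)
  qed
  have inv: "follows_waiter \<sigma> h \<longrightarrow> I h" if "legal_history X q h" for h
    using that
  proof induction
    case start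
    show ?case by (simp add: init)
  next
    case (round h A c)
    have "claimed h \<noteq> X"
      using round by (auto simp: legal_offer_def)
    then show ?case
      using \<sigma>[of h] round by (auto simp: follows_waiter_snoc)
  qed
  show ?thesis
    unfolding waiter_has_winning_strategy_def waiter_strategy_def
    using \<sigma> inv final by (intro exI[of _ \<sigma>]) (auto simp: complete_play_def)
qed

section \<open>Client's transversal strategy\<close>

text \<open>A uniformly random choice from \<open>A\<close> misses a set meeting \<open>A\<close> in
  \<open>j\<close> elements with probability \<open>1 - j / card A\<close>, which is at most
  \<open>a ^ j\<close> by Bernoulli's inequality for \<open>a = 1 - 1 / (q + 1)\<close>. This pays
  for the drop by \<open>j\<close> of the exponent in the weight of a missed set.\<close>

lemma client_transversal:
  fixes \<B> :: "'a set set"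
  assumes finX: "finite X" and sub: "\<And>B. B \<in> \<B> \<Longrightarrow> B \<subseteq> X"
    and small: "(\<Sum>B\<in>\<B>. (real q / (real q + 1)) ^ card B) < 1"
    and win: "\<And>h. \<lbrakk>complete_play X q h; \<And>B. B \<in> \<B> \<Longrightarrow> B \<inter> client_claimed h \<noteq> {}\<rbrakk>
      \<Longrightarrow> client_wins_play \<F> h"
  shows "client_has_winning_strategy X \<F> q"
proof -
  define a where "a = real q / (real q + 1)"
  have a: "0 \<le> a" "a = 1 - 1 / (real q + 1)"
    by (auto simp: a_def field_simps)
  have fin: "finite \<B>"
    using sub finX by (meson Pow_iff finite_Pow_iff finite_subset subsetI)
  define U where "U h = {B\<in>\<B>. B \<inter> client_claimed h = {}}" for h :: "'a history"
  define \<Phi> where "\<Phi> h = (\<Sum>B\<in>U h. a ^ card (B - claimed h))" for h :: "'a history"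
  have finU: "finite (U h)" for h
    using fin by (simp add: U_def)
  show ?thesis
  proof (rule client_wins_by_invariant[of "\<lambda>h. \<Phi> h < 1"])
    show "\<Phi> [] < 1"
      using small by (simp add: \<Phi>_def U_def a_def)
  next
    fix h A
    assume h: "legal_history X q h" and \<Phi>: "\<Phi> h < 1" and A: "legal_offer X q h A"
    have A': "A \<subseteq> X - claimed h" "card A \<le> q + 1" "card A \<ge> 1" "finite A"
      using A finX by (auto simp: legal_offer_def intro: finite_subset)
    have new: "\<Phi> (h @ [(A, c)]) = (\<Sum>B\<in>U h. if c \<in> B then 0 else a ^ card (B - claimed h - A))"
      for c
    proof -
      have "U (h @ [(A, c)]) = {B\<in>U h. c \<notin> B}"
        by (auto simp: U_def)
      then have "\<Phi> (h @ [(A, c)]) = (\<Sum>B\<in>{B\<in>U h. c \<notin> B}. a ^ card (B - claimed h - A))"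
        by (simp add: \<Phi>_def Diff_eq ac_simps)
      also have "\<dots> = (\<Sum>B\<in>U h. if c \<notin> B then a ^ card (B - claimed h - A) else 0)"
        by (rule sum.inter_filter[OF finU])
      finally show ?thesis
        by (simp add: if_distrib cong: if_cong) (meson)
    qed
    have loss: "(\<Sum>c\<in>A. if c \<in> B then 0 else a ^ card (B - claimed h - A))
        \<le> real (card A) * a ^ card (B - claimed h)" if "B \<in> U h" for B
    proof -
      let ?j = "card (A \<inter> B)"
      have "B \<in> \<B>"
        using that by (simp add: U_def)
      then have finB: "finite B"
        using sub finX finite_subset by blast
      have "B - claimed h = (B - claimed h - A) \<union> (A \<inter> B)"
        using A' by auto
      then have cB: "card (B - claimed h) = card (B - claimed h - A) + ?j"
        using finB A'(4) by (metis Diff_disjoint Int_assoc Int_commute Int_empty_right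
            card_Un_disjoint finite_Diff finite_Int)
      have "?j \<le> card A"
        using A' by (simp add: card_mono)
      \<comment> \<open>An offer of fewer than \<open>q + 1\<close> elements only makes a miss less
        likely.\<close>
      have "1 - real ?j / card A \<le> 1 - real ?j / (real q + 1)"
        using A' by (intro diff_left_mono divide_left_mono) auto
      also have "\<dots> = 1 + real ?j * (- (1 / (real q + 1)))"
        by simp
      also have "\<dots> \<le> (1 + (- (1 / (real q + 1)))) ^ ?j"
        by (rule Bernoulli_inequality) simp
      also have "\<dots> = a ^ ?j"
        by (simp add: a)
      finally have "real (card A) * (1 - real ?j / card A) \<le> real (card A) * a ^ ?j"
        by (intro mult_left_mono) auto
      then have bern: "real (card A) - real ?j \<le> real (card A) * a ^ ?j"
        using A'(3) by (simp add: right_diff_distrib)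
      have "(\<Sum>c\<in>A. if c \<in> B then 0 else a ^ card (B - claimed h - A))
          = (\<Sum>c\<in>A - B. a ^ card (B - claimed h - A))"
        using A'(4) by (simp add: sum.If_cases Diff_eq)
      also have "\<dots> = (real (card A) - real ?j) * a ^ card (B - claimed h - A)"
        using A' \<open>?j \<le> card A\<close> by (simp add: card_Diff_subset_Int of_nat_diff)
      also have "\<dots> \<le> (real (card A) * a ^ ?j) * a ^ card (B - claimed h - A)"
        using bern a(1) by (intro mult_right_mono) auto
      finally show ?thesis
        by (simp add: cB power_add mult_ac)
    qed
    have "(\<Sum>c\<in>A. \<Phi> (h @ [(A, c)])) \<le> (\<Sum>B\<in>U h. real (card A) * a ^ card (B - claimed h))"
      unfolding new by (subst sum.swap) (intro sum_mono loss)
    also have "\<dots> = real (card A) * \<Phi> h"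
      by (simp add: \<Phi>_def sum_distrib_left)
    also have "\<dots> < real (card A)"
      using \<Phi> A' by simp
    finally have "\<not> (\<forall>c\<in>A. 1 \<le> \<Phi> (h @ [(A, c)]))"
      using sum_mono[of A "\<lambda>_. 1" "\<lambda>c. \<Phi> (h @ [(A, c)])"] by auto
    then show "\<exists>c\<in>A. \<Phi> (h @ [(A, c)]) < 1"
      by force
  next
    fix h
    assume h: "complete_play X q h" and \<Phi>: "\<Phi> h < 1"
    \<comment> \<open>Nothing is left unclaimed, so a set never hit has weight
      \<open>a ^ 0 = 1\<close> and \<open>\<Phi> h\<close> counts these sets.\<close>
    have "card (B - claimed h) = 0" if "B \<in> U h" for B
      using that h sub by (metis (lifting) Diff_eq_empty_iff U_def card.empty complete_play_def mem_Collect_eq)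
    then have "\<Phi> h = real (card (U h))"
      by (simp add: \<Phi>_def)
    then have "U h = {}"
      using \<Phi> finU by simp
    then show "client_wins_play \<F> h"
      using h by (intro win) (auto simp: U_def)
  qed
qed

section \<open>Two-colourability\<close>

text \<open>If at most two classes cover \<open>n\<close> vertices, one of them has at least half of
  the vertices and so contains an edge.\<close>

lemma weak_chromatic_number_gt_2:
  assumes "k \<ge> 2" "F \<subseteq> complete_edges k n"
    and hit: "\<And>S. \<lbrakk>S \<subseteq> {..<n}; n \<le> 2 * card S\<rbrakk> \<Longrightarrow> \<not> independent F S"
  shows "weak_chromatic_number {..<n} F > 2"
proof -
  let ?Q = "\<lambda>r P. partition_on {..<n} P \<and> finite P \<and> card P = r \<and> (\<forall>S\<in>P. independent F S)"
  \<comment> \<open>Singletons contain no edge because \<open>k \<ge> 2\<close>; this partition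
    shows that the \<open>LEAST\<close> is attained.\<close>
  let ?P = "(\<lambda>v. {v}) ` {..<n}"
  have "partition_on {..<n} ?P"
    by (auto simp: partition_on_def disjoint_def)
  moreover have "independent F {v}" for v
    unfolding independent_def
  proof
    fix e assume "e \<in> F"
    then have "card e \<ge> 2"
      using assms by (auto simp: complete_edges_def)
    then show "\<not> e \<subseteq> {v}"
      using card_mono[of "{v}" e] by auto
  qed
  ultimately have "?Q (card ?P) ?P"
    by auto
  then have "\<exists>r P. ?Q r P"
    by blast
  then have "\<exists>P. ?Q (weak_chromatic_number {..<n} F) P"
    unfolding weak_chromatic_number_def by (rule LeastI_ex)
  then obtain P where P: "?Q (weak_chromatic_number {..<n} F) P" ..
  show ?thesis
  proof (rule ccontr)
    assume "\<not> ?thesis"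
    then have P2: "card P \<le> 2"
      using P by auto
    have "2 * card S < n" if "S \<in> P" for S
      using hit[of S] that P by (force simp: partition_on_def)
    then have small: "card S \<le> (n - 1) div 2" if "S \<in> P" for S
      using that by fastforce
    have "n = card (\<Union>P)"
      using P by (auto simp: partition_on_def)
    also have "\<dots> \<le> (\<Sum>S\<in>P. card S)"
      using card_Union_le_sum_card .
    also have "\<dots> \<le> card P * ((n - 1) div 2)"
      using sum_bounded_above[of P card, OF small] by simp
    also have "\<dots> \<le> 2 * ((n - 1) div 2)"
      using P2 by (intro mult_right_mono) auto
    finally have "n = 0"
      by linarith
    \<comment> \<open>For \<open>n = 0\<close> the empty set counts as half of the vertices and
      would have to contain an edge.\<close>
    then have "\<not> independent F {}"
      using hit by simp
    moreover have "{} \<notin> F"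
      using assms by (auto simp: complete_edges_def)
    ultimately show False
      by (auto simp: independent_def)
  qed
qed

lemma weak_chromatic_number_le_2:
  fixes V :: "'v set" and c :: "'v \<Rightarrow> bool"
  assumes "\<And>e. e \<in> F \<Longrightarrow> \<exists>u\<in>e. \<exists>v\<in>e. c u \<noteq> c v"
  shows "weak_chromatic_number V F \<le> 2"
proof -
  \<comment> \<open>A colour class may be empty, but a block of a partition may not.\<close>
  let ?P = "{{v\<in>V. c v}, {v\<in>V. \<not> c v}} - {{}}"
  have "partition_on V ?P"
    by (auto simp: partition_on_def disjoint_def)
  moreover have "\<forall>S\<in>?P. independent F S"
    using assms by (fastforce simp: independent_def)
  ultimately have "weak_chromatic_number V F \<le> card ?P"
    unfolding weak_chromatic_number_def by (intro Least_le exI[of _ ?P]) auto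
  also have "\<dots> \<le> card {{v\<in>V. c v}, {v\<in>V. \<not> c v}}"
    by (intro card_mono) auto
  also have "\<dots> \<le> 2"
    by (simp add: card_insert_if)
  finally show ?thesis .
qed

section \<open>Client's potential for the cliques on half of the vertices\<close>

lemma finite_complete_edges: "finite (complete_edges k n)"
  by (rule finite_subset[of _ "Pow {..<n}"]) (auto simp: complete_edges_def)

text \<open>At most \<open>2 ^ n\<close> cliques have to be hit, each with \<open>N\<close> edges,
  so their weights sum to at most \<open>2 ^ n * exp (- N / (q + 1))\<close>. This is below 1 once
  \<open>n * ln 2 < N / (q + 1)\<close>.\<close>

lemma client_wins_non_2_colourability:
  assumes k: "k \<ge> 2" and q: "q \<ge> 1"
    and bound: "real q \<le> real (nat \<lceil>real n / 2\<rceil> choose k) * (ln 2 / ((1 + ln 2) * real n))"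
  shows "client_has_winning_strategy (complete_edges k n) (NC2 k n) q"
proof -
  define m where "m = nat \<lceil>real n / 2\<rceil>"
  \<comment> \<open>This turns the ceiling into the size condition of
    \<open>weak_chromatic_number_gt_2\<close>.\<close>
  have m: "m \<le> M \<longleftrightarrow> n \<le> 2 * M" for M
    unfolding m_def by (simp add: nat_le_iff ceiling_le_iff field_simps) linarith
  \<comment> \<open>At \<open>n = 0\<close> division by zero makes the bound 0, against
    \<open>q \<ge> 1\<close>.\<close>
  have n: "n > 0"
    using bound q by (cases n) auto
  let ?K = "\<lambda>S. {e. e \<subseteq> S \<and> card e = k}"
  define \<B> where "\<B> = ?K ` {S. S \<subseteq> {..<n} \<and> card S = m}"
  define N where "N = (m choose k)"
  define l where "l = (ln 2 :: real)"
  have l: "0 < l" "l < 1"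
    using ln_less_self[of 2] ln_2_less_1 by (auto simp: l_def)
  have q': "real q * ((1 + l) * real n) \<le> real N * l"
    using bound n l unfolding m_def[symmetric] N_def[symmetric] l_def[symmetric]
    by (simp add: field_simps add_pos_pos)
  have "real N > 0"
  proof -
    have "0 < real q * ((1 + l) * real n)"
      using q n l by simp
    then show ?thesis
      using q' l by (smt (verit) zero_less_mult_iff)
  qed
  \<comment> \<open>The hypothesis bounds \<open>q\<close>, while the exponent involves
    \<open>q + 1\<close>. Estimating \<open>q + 1 \<le> 2 * q\<close> costs a factor 2, which is
    affordable because \<open>2 * l * l < 1 + l\<close>.\<close>
  have "(1 + l) * (real n * l * (real q + 1)) \<le> (1 + l) * (real n * l * (2 * real q))"
    using q n l by (intro mult_left_mono) auto
  also have "\<dots> = 2 * l * (real q * ((1 + l) * real n))"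
    by (simp add: algebra_simps)
  also have "\<dots> \<le> 2 * l * (real N * l)"
    using q' l by (intro mult_left_mono) auto
  also have "\<dots> = (2 * l * l) * real N"
    by simp
  also have "\<dots> < (1 + l) * real N"
  proof -
    \<comment> \<open>The product expands to \<open>1 + l - 2 * l * l\<close>.\<close>
    have "(2 * l + 1) * (1 - l) > 0"
      using l by (intro mult_pos_pos) auto
    then have "2 * l * l < 1 + l"
      by (simp add: algebra_simps)
    then show ?thesis
      using \<open>real N > 0\<close> by (intro mult_strict_right_mono) auto
  qed
  finally have "real n * l * (real q + 1) < real N"
    using l by simp
  then have exponent: "real n * l < real N / (real q + 1)"
    by (simp add: field_simps)
  have card: "card B = N" if "B \<in> \<B>" for B
    using that finite_subset[OF _ finite_lessThan[of n]] by (auto simp: \<B>_def N_def n_subsets)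
  have "card \<B> \<le> card {S. S \<subseteq> {..<n} \<and> card S = m}"
    unfolding \<B>_def by (rule card_image_le) (auto intro: finite_subset[of _ "Pow {..<n}"])
  also have "\<dots> \<le> card (Pow {..<n})"
    by (intro card_mono) auto
  finally have "card \<B> \<le> 2 ^ n"
    by (simp add: card_Pow)
  \<comment> \<open>This is \<open>1 - t \<le> exp (- t)\<close> at
    \<open>t = 1 / (q + 1)\<close>.\<close>
  have a: "real q / (real q + 1) \<le> exp (- 1 / (real q + 1))"
    using exp_ge_add_one_self[of "- 1 / (real q + 1)"] by (simp add: field_simps)
  have "(\<Sum>B\<in>\<B>. (real q / (real q + 1)) ^ card B) = card \<B> * (real q / (real q + 1)) ^ N"
    by (simp add: card)
  also have "\<dots> \<le> 2 ^ n * exp (- 1 / (real q + 1)) ^ N"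
  proof (intro mult_mono power_mono a)
    show "real (card \<B>) \<le> 2 ^ n"
      using of_nat_mono[OF \<open>card \<B> \<le> 2 ^ n\<close>, where 'a = real] by simp
  qed auto
  also have "\<dots> = exp (real n * l) * exp (- (real N / (real q + 1)))"
    using exp_of_nat_mult[of n l] exp_of_nat_mult[of N "- 1 / (real q + 1)"] by (simp add: l_def)
  also have "\<dots> = exp (real n * l - real N / (real q + 1))"
    by (simp add: exp_add[symmetric])
  also have "\<dots> < 1"
    using exponent by simp
  finally have small: "(\<Sum>B\<in>\<B>. (real q / (real q + 1)) ^ card B) < 1" .
  show ?thesis
  proof (rule client_transversal[OF finite_complete_edges _ small])
    show "B \<subseteq> complete_edges k n" if "B \<in> \<B>" for B
      using that by (auto simp: \<B>_def complete_edges_def)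
  next
    fix h
    assume h: "complete_play (complete_edges k n) q h"
      and hit: "\<And>B. B \<in> \<B> \<Longrightarrow> B \<inter> client_claimed h \<noteq> {}"
    let ?F = "client_claimed h"
    have F: "?F \<subseteq> complete_edges k n"
      using h client_claimed_subset claimed_subset unfolding complete_play_def by blast
    have "\<not> independent ?F S" if S: "S \<subseteq> {..<n}" "n \<le> 2 * card S" for S
    proof -
      obtain T where T: "T \<subseteq> S" "card T = m"
        using obtain_subset_with_card_n[of m S] m S by auto
      then have "?K T \<in> \<B>"
        using S by (auto simp: \<B>_def)
      then obtain e where "e \<in> ?F" "e \<subseteq> T"
        using hit by fastforce
      then show ?thesis
        using T by (auto simp: independent_def)
    qed
    then have "?F \<in> NC2 k n"
      using weak_chromatic_number_gt_2[OF k F] F by (simp add: NC2_def)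
    then show "client_wins_play (NC2 k n) h"
      by (auto simp: client_wins_play_def)
  qed
qed

section \<open>Waiter's pairing strategy\<close>

text \<open>The bit \<open>x i\<close> is the colour of vertex \<open>2 * i\<close>, and
  \<open>2 * i + 1\<close> gets the opposite one, so every \<open>x\<close> gives a colouring that
  is balanced on each initial run of pairs.\<close>

definition pair_colour :: "(nat \<Rightarrow> bool) \<Rightarrow> nat \<Rightarrow> bool" where
  "pair_colour x v \<longleftrightarrow> (x (v div 2) \<longleftrightarrow> even v)"

text \<open>Only \<open>f\<close> is required to be monochromatic, so the offer is determined before
  pair \<open>i\<close> is coloured. The condition \<open>v < n\<close> drops the missing partner in
  the last pair when \<open>n\<close> is odd.\<close>

definition pair_offer :: "nat \<Rightarrow> nat \<Rightarrow> (nat \<Rightarrow> bool) \<Rightarrow> nat \<Rightarrow> nat set set" where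
  "pair_offer k n x i = {insert v f | v f. v < n \<and> v div 2 = i \<and> f \<subseteq> {..<2 * i} \<and> card f = k - 1 \<and>
     (\<exists>b. \<forall>u\<in>f. pair_colour x u = b)}"

lemma pair_offer_subset:
  assumes "k \<ge> 2"
  shows "pair_offer k n x i \<subseteq> complete_edges k n"
proof
  fix e assume "e \<in> pair_offer k n x i"
  then obtain v f where vf: "e = insert v f" "v < n" "v div 2 = i" "f \<subseteq> {..<2 * i}" "card f = k - 1"
    by (auto simp: pair_offer_def)
  then have "finite f" "v \<notin> f" "f \<subseteq> {..<n}"
    using finite_subset by fastforce+
  then show "e \<in> complete_edges k n"
    using vf assms by (simp add: complete_edges_def)
qed

text \<open>The first fact keeps a new offer free of edges claimed for earlier pairs; the second
  preserves this for the next pair.\<close>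

lemma pair_offer_above:
  assumes "e \<in> pair_offer k n x i"
  shows "\<not> e \<subseteq> {..<2 * i}" "e \<subseteq> {..<2 * Suc i}"
  using assms by (auto simp: pair_offer_def)

text \<open>Lets the colour of pair \<open>i\<close> be chosen after its offer, without altering
  that offer or an earlier one.\<close>

lemma pair_offer_cong:
  assumes "\<And>j. j < i \<Longrightarrow> x j = y j"
  shows "pair_offer k n x i = pair_offer k n y i"
proof -
  have "pair_colour x u = pair_colour y u" if "u < 2 * i" for u
    using assms that by (auto simp: pair_colour_def less_mult_imp_div_less mult.commute)
  then have "(\<exists>b. \<forall>u\<in>f. pair_colour x u = b) \<longleftrightarrow> (\<exists>b. \<forall>u\<in>f. pair_colour y u = b)"
    if "f \<subseteq> {..<2 * i}" for f
    using that by (metis lessThan_iff subsetD)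
  then show ?thesis
    unfolding pair_offer_def by (auto cong: conj_cong)
qed

text \<open>A monochromatic edge contains no full pair, so its vertices other than the largest lie
  in earlier pairs. Hence the offers cover every edge that the colouring could fail to
  split.\<close>

lemma mono_edge_in_pair_offer:
  assumes "k \<ge> 2" "e \<in> complete_edges k n" "\<And>v. v \<in> e \<Longrightarrow> pair_colour x v = b"
  shows "e \<in> pair_offer k n x (Max e div 2)"
proof -
  let ?v = "Max e"
  have e: "finite e" "e \<subseteq> {..<n}" "card e = k" "e \<noteq> {}"
    using assms by (auto simp: complete_edges_def intro: finite_subset)
  then have v: "?v \<in> e"
    using Max_in by blast
  have "u < 2 * (?v div 2)" if u: "u \<in> e - {?v}" for u
  proof (rule ccontr)
    assume *: "\<not> ?thesis"
    have "u < ?v"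
      using u e by (simp add: order_neq_le_trans)
    \<comment> \<open>The only candidate is the even partner of an odd \<open>?v\<close>, and it has
      the opposite colour.\<close>
    then have "even u" "odd ?v" "u div 2 = ?v div 2"
      using * by presburger+
    moreover have "pair_colour x u = pair_colour x ?v"
      using assms(3) u v by simp
    ultimately show False
      by (simp add: pair_colour_def)
  qed
  moreover have "e = insert ?v (e - {?v})" "card (e - {?v}) = k - 1"
    using e(3) v by (simp_all add: insert_absorb)
  moreover have "?v < n"
    using v e by blast
  ultimately show ?thesis
    using assms(3) unfolding pair_offer_def
    by (intro CollectI exI[of _ ?v] exI[of _ "e - {?v}"]) auto
qed

section \<open>Sizes of Waiter's offers\<close>

lemma card_pair_colour_class:
  "finite {u\<in>{..<2 * i}. pair_colour x u = b}" "card {u\<in>{..<2 * i}. pair_colour x u = b} = i"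
proof -
  show "finite {u\<in>{..<2 * i}. pair_colour x u = b}"
    by simp
  \<comment> \<open>Each pair has exactly one vertex of colour \<open>b\<close>; the inverse map
    picks it.\<close>
  have "bij_betw (\<lambda>u. u div 2) {u\<in>{..<2 * i}. pair_colour x u = b} {..<i}"
  proof (rule bij_betwI[where g = "\<lambda>j. if x j = b then 2 * j else 2 * j + 1"])
    show "(if x (u div 2) = b then 2 * (u div 2) else 2 * (u div 2) + 1) = u"
      if "u \<in> {u\<in>{..<2 * i}. pair_colour x u = b}" for u
      using that by (auto simp: pair_colour_def)
  qed (auto simp: pair_colour_def)
  then show "card {u\<in>{..<2 * i}. pair_colour x u = b} = i"
    by (auto dest: bij_betw_same_card)
qed

text \<open>The factor 4 comes from two choices of \<open>v\<close> and two colours for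
  \<open>f\<close>; by balance each colour class has \<open>i\<close> vertices.\<close>

lemma card_pair_offer_le: "card (pair_offer k n x i) \<le> 4 * (i choose (k - 1))"
proof -
  let ?C = "\<lambda>b. {f. f \<subseteq> {u\<in>{..<2 * i}. pair_colour x u = b} \<and> card f = k - 1}"
  let ?D = "{2 * i, 2 * i + 1} \<times> (?C True \<union> ?C False)"
  have fin: "finite (?C b)" for b
    by (rule finite_subset[of _ "Pow {u\<in>{..<2 * i}. pair_colour x u = b}"]) auto
  have "pair_offer k n x i \<subseteq> (\<lambda>(v, f). insert v f) ` ?D"
  proof
    fix e assume "e \<in> pair_offer k n x i"
    then obtain v f b where vf: "e = insert v f" "v div 2 = i" "f \<subseteq> {..<2 * i}" "card f = k - 1"
      "\<forall>u\<in>f. pair_colour x u = b"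
      by (auto simp: pair_offer_def)
    have "v = 2 * i \<or> v = 2 * i + 1"
      using vf(2) by presburger
    moreover have "f \<in> ?C b"
      using vf by auto
    then have "f \<in> ?C True \<union> ?C False"
      by (cases b) auto
    ultimately have "(v, f) \<in> ?D"
      by blast
    then show "e \<in> (\<lambda>(v, f). insert v f) ` ?D"
      using vf(1) by force
  qed
  then have "card (pair_offer k n x i) \<le> card ?D"
    using fin by (intro surj_card_le) auto
  also have "\<dots> = 2 * card (?C True \<union> ?C False)"
    by (subst card_cartesian_product) simp
  also have "\<dots> \<le> 2 * (card (?C True) + card (?C False))"
    by (intro mult_left_mono card_Un_le) simp
  also have "\<dots> = 4 * (i choose (k - 1))"
    by (subst (1 2) n_subsets[OF card_pair_colour_class(1)]) (simp only: card_pair_colour_class(2), simp)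
  finally show ?thesis .
qed

text \<open>Absorption splits off a factor \<open>2 * i\<close> on the left and \<open>N\<close> on
  the right; \<open>2 * (i - 1) \<le> N - 1\<close> then lets the induction continue.\<close>

lemma power_2_mult_binomial_le: "2 * i \<le> N \<Longrightarrow> 2 ^ t * (i choose t) \<le> (N choose t)"
proof (induction t arbitrary: i N)
  case (Suc t)
  show ?case
  proof (cases i)
    case (Suc i')
    then obtain N' where N: "N = Suc N'"
      using Suc.prems by (cases N) auto
    have IH: "2 ^ t * (i' choose t) \<le> (N' choose t)"
      using Suc.IH[of i' N'] Suc.prems Suc N by simp
    have "Suc t * (2 ^ Suc t * (i choose Suc t)) = (2 * i) * (2 ^ t * (i' choose t))"
      using arg_cong[OF Suc_times_binomial[of t i'], of "\<lambda>a. 2 ^ Suc t * a"] Suc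
      by (simp only: mult_ac power_Suc)
    also have "\<dots> \<le> N * (N' choose t)"
      using IH Suc.prems by (intro mult_mono) auto
    also have "\<dots> = Suc t * (N choose Suc t)"
      using Suc_times_binomial[of t N'] N by simp
    finally show ?thesis
      by (simp only: Suc_mult_le_cancel1)
  qed simp
qed simp

lemma waiter_wins_non_2_colourability:
  assumes k: "k \<ge> 2"
    and bound: "\<And>i. 2 * i < n \<Longrightarrow> 4 * (i choose (k - 1)) \<le> q + 1"
  shows "waiter_has_winning_strategy (complete_edges k n) (NC2 k n) q"
proof -
  let ?X = "complete_edges k n"
  \<comment> \<open>The pairs below \<open>j\<close> are settled: their offers are used up and
    \<open>x\<close> splits every edge of Client. As claimed edges lie below \<open>2 * j\<close>,
    the bits of \<open>x\<close> from \<open>j\<close> on can still be changed.\<close>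
  define good where "good h j x \<longleftrightarrow> (\<forall>i<j. pair_offer k n x i \<subseteq> claimed h) \<and>
      (\<forall>e\<in>claimed h. e \<subseteq> {..<2 * j}) \<and>
      (\<forall>e\<in>client_claimed h. \<exists>u\<in>e. \<exists>v\<in>e. pair_colour x u \<noteq> pair_colour x v)"
    for h :: "nat set history" and j x
  show ?thesis
  proof (rule waiter_wins_by_invariant[of "\<lambda>h. \<exists>j x. good h j x"])
    show "\<exists>j x. good [] j x"
      by (intro exI[of _ 0]) (simp add: good_def)
  next
    fix h
    assume h: "legal_history ?X q h" and inv: "\<exists>j x. good h j x" and "claimed h \<noteq> ?X"
    then obtain e\<^sub>0 where e\<^sub>0: "e\<^sub>0 \<in> ?X" "e\<^sub>0 \<notin> claimed h"
      using claimed_subset by blast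
    \<comment> \<open>An offer must be nonempty, so pairs with an empty \<open>pair_offer\<close>
      are skipped; after enough skips \<open>n \<le> 2 * j\<close>.\<close>
    obtain j x where jx: "good h j x" and next_pair: "n \<le> 2 * j \<or> pair_offer k n x j \<noteq> {}"
    proof -
      obtain j\<^sub>0 x where "good h j\<^sub>0 x"
        using inv by blast
      have "\<exists>j. good h j x \<and> (n \<le> 2 * j \<or> pair_offer k n x j \<noteq> {})"
      proof (rule ccontr)
        assume *: "\<not> ?thesis"
        have "good h (Suc j) x" if "good h j x" for j
        proof -
          have "pair_offer k n x j = {}"
            using that * by blast
          moreover have "e \<subseteq> {..<2 * Suc j}" if "e \<in> claimed h" for e
            using that \<open>good h j x\<close> by (fastforce simp: good_def)
          ultimately show ?thesis
            using that by (auto simp: good_def less_Suc_eq)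
        qed
        then have "good h (j\<^sub>0 + d) x" for d
          using \<open>good h j\<^sub>0 x\<close> by (induction d) auto
        then have "good h (j\<^sub>0 + n) x" .
        then show False
          using * by auto
      qed
      then show thesis
        using that by blast
    qed
    show "\<exists>A. legal_offer ?X q h A \<and> (\<forall>c\<in>A. \<exists>j x. good (h @ [(A, c)]) j x)"
    proof (cases "n \<le> 2 * j")
      \<comment> \<open>All pairs are coloured. A monochromatic edge would belong to an offer
        already claimed, so the free edge \<open>e\<^sub>0\<close> is split by \<open>x\<close> and
        can safely be offered alone.\<close>
      case True
      have "e\<^sub>0 \<noteq> {}" "finite e\<^sub>0"
        using e\<^sub>0(1) k by (auto simp: complete_edges_def intro: finite_subset)
      then have max: "Max e\<^sub>0 \<in> e\<^sub>0"
        by (rule Max_in[rotated])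
      have "\<exists>u\<in>e\<^sub>0. \<exists>v\<in>e\<^sub>0. pair_colour x u \<noteq> pair_colour x v"
      proof (rule ccontr)
        assume "\<not> ?thesis"
        then have "\<And>v. v \<in> e\<^sub>0 \<Longrightarrow> pair_colour x v = pair_colour x (Max e\<^sub>0)"
          using max by blast
        then have "e\<^sub>0 \<in> pair_offer k n x (Max e\<^sub>0 div 2)"
          by (rule mono_edge_in_pair_offer[OF k e\<^sub>0(1)])
        moreover have "Max e\<^sub>0 < n"
          using max e\<^sub>0(1) by (auto simp: complete_edges_def)
        then have "Max e\<^sub>0 div 2 < j"
          using True by (simp add: less_mult_imp_div_less)
        ultimately show False
          using jx e\<^sub>0(2) by (auto simp: good_def)
      qed
      moreover have "e\<^sub>0 \<subseteq> {..<2 * j}"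
        using e\<^sub>0(1) True by (auto simp: complete_edges_def)
      ultimately have "good (h @ [({e\<^sub>0}, e\<^sub>0)]) j x"
        using jx by (auto simp: good_def)
      moreover have "legal_offer ?X q h {e\<^sub>0}"
        using e\<^sub>0 by (simp add: legal_offer_def)
      ultimately show ?thesis
        by blast
    next
      case False
      let ?A = "pair_offer k n x j"
      have sub: "?A \<subseteq> ?X - claimed h"
        using pair_offer_subset[OF k] pair_offer_above(1) jx by (fastforce simp: good_def)
      then have "finite ?A"
        using finite_complete_edges finite_subset by blast
      then have "card ?A \<ge> 1"
        using next_pair False by (simp add: Suc_le_eq card_gt_0_iff)
      then have legal: "legal_offer ?X q h ?A"
        using sub card_pair_offer_le[of k n x j] bound[of j] False by (simp add: legal_offer_def)
      have "\<exists>y. good (h @ [(?A, e)]) (Suc j) y" if e: "e \<in> ?A" for e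
      proof -
        obtain v f b where vf: "e = insert v f" "v div 2 = j" "f \<subseteq> {..<2 * j}" "card f = k - 1"
          "\<forall>u\<in>f. pair_colour x u = b"
          using e by (auto simp: pair_offer_def)
        \<comment> \<open>The parity of \<open>v\<close> converts the wish that \<open>v\<close>
          avoid colour \<open>b\<close> into the bit of its pair.\<close>
        define y where "y = x(j := (b \<longleftrightarrow> odd v))"
        have old: "pair_colour y u = pair_colour x u" if "u < 2 * j" for u
          using that by (auto simp: pair_colour_def y_def)
        \<comment> \<open>Since \<open>k - 1 \<ge> 1\<close>, the colour \<open>b\<close> does occur
          in \<open>e\<close>.\<close>
        obtain u where u: "u \<in> f"
          using vf(4) k by (cases "f = {}") auto
        then have "pair_colour y u = b"
          using vf old by auto
        moreover have "pair_colour y v \<noteq> b"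
          using vf(2) by (auto simp: pair_colour_def y_def)
        ultimately have new: "\<exists>u\<in>e. \<exists>v\<in>e. pair_colour y u \<noteq> pair_colour y v"
          using u vf(1) by blast
        \<comment> \<open>The range includes \<open>i = j\<close>: the set just offered was computed
          from \<open>x\<close> and has to be the offer for \<open>y\<close> as well.\<close>
        have offers: "pair_offer k n y i = pair_offer k n x i" if "i < Suc j" for i
          using that by (intro pair_offer_cong) (auto simp: y_def)
        have keep: "\<exists>u\<in>g. \<exists>v\<in>g. pair_colour y u \<noteq> pair_colour y v" if "g \<in> client_claimed h" for g
        proof -
          have "g \<subseteq> {..<2 * j}"
            using that jx client_claimed_subset[OF h] by (auto simp: good_def)
          then show ?thesis
            using that jx old unfolding good_def by (smt (verit) lessThan_iff subsetD)
        qed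
        have "\<forall>g\<in>claimed h \<union> ?A. g \<subseteq> {..<2 * Suc j}"
          using jx pair_offer_above(2) by (fastforce simp: good_def)
        then have "good (h @ [(?A, e)]) (Suc j) y"
          using jx new keep offers by (auto simp: good_def less_Suc_eq)
        then show ?thesis by blast
      qed
      then show ?thesis
        using legal by blast
    qed
  next
    fix h
    assume "\<exists>j x. good h j x"
    then obtain j x where "good h j x"
      by blast
    then have x: "\<forall>e\<in>client_claimed h. \<exists>u\<in>e. \<exists>v\<in>e. pair_colour x u \<noteq> pair_colour x v"
      by (simp add: good_def)
    show "\<not> client_wins_play (NC2 k n) h"
    proof
      assume "client_wins_play (NC2 k n) h"
      then obtain W where "W \<subseteq> client_claimed h" "weak_chromatic_number {..<n} W > 2"
        by (auto simp: client_wins_play_def NC2_def)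
      moreover from this(1) have "weak_chromatic_number {..<n} W \<le> 2"
        using x by (intro weak_chromatic_number_le_2[where c = "pair_colour x"]) blast
      ultimately show False
        by simp
    qed
  qed
qed

text \<open>Absorption turns the threshold into
  \<open>k ^ 2 * 2 powr (5 - k) * (n - 1 choose (k - 1))\<close>, where
  \<open>2 powr (5 - k) = 16 / 2 ^ (k - 1)\<close>. By \<open>power_2_mult_binomial_le\<close> this
  is at least \<open>16 * k ^ 2 * (i choose (k - 1))\<close>.\<close>

lemma pair_offer_fits:
  assumes k: "k \<ge> 2" and i: "2 * i < n"
    and q: "real q \<ge> real k ^ 3 * 2 powr (- real k + 5) * real (n choose k) / real n"
  shows "4 * (i choose (k - 1)) \<le> q + 1"
proof -
  obtain t n' where t: "k = Suc t" and n: "n = Suc n'"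
    using k i by (cases k; cases n) auto
  have absorb: "real k * real (n choose k) = real n * real (n' choose t)"
    using Suc_times_binomial[of t n'] unfolding t n by (metis of_nat_mult)
  have p: "2 powr (- real k + 5) * 2 ^ t = (16::real)"
  proof -
    have "2 powr (- real k + 5) * 2 ^ t = (2::real) powr (- real k + 5) * 2 powr real t"
      by (simp add: powr_realpow)
    also have "\<dots> = 2 powr (- real k + 5 + real t)"
      by (simp only: powr_add)
    also have "\<dots> = 2 powr 4"
      by (simp add: t)
    finally show ?thesis
      by simp
  qed
  have "real (4 * (i choose t)) \<le> 16 * real (i choose t)"
    by simp
  also have "\<dots> = 2 powr (- real k + 5) * (2 ^ t * real (i choose t))"
    by (simp only: p[symmetric] mult.assoc)
  also have "\<dots> \<le> 2 powr (- real k + 5) * real (n' choose t)"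
  proof (intro mult_left_mono)
    have "2 ^ t * (i choose t) \<le> (n' choose t)"
      using i n by (intro power_2_mult_binomial_le) simp
    then show "2 ^ t * real (i choose t) \<le> real (n' choose t)"
      using of_nat_mono by fastforce
  qed simp
  also have "\<dots> \<le> real k ^ 2 * (2 powr (- real k + 5) * real (n' choose t))"
    using mult_right_mono[of 1 "real k ^ 2" "2 powr (- real k + 5) * real (n' choose t)"] k by simp
  also have "\<dots> = real k ^ 2 * 2 powr (- real k + 5) * (real n * real (n' choose t)) / real n"
    using i by simp
  also have "\<dots> = real k ^ 3 * 2 powr (- real k + 5) * real (n choose k) / real n"
    unfolding absorb[symmetric] by (simp add: power3_eq_cube power2_eq_square)
  finally have "real (4 * (i choose t)) \<le> real q"
    using q by linarith
  then show ?thesis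
    by (simp add: t of_nat_le_iff[symmetric, where 'a = real] del: of_nat_le_iff)
qed

theorem theorem1p2:
  fixes k :: nat
  assumes "k \<ge> 2"
  shows "\<exists>n\<^sub>0::nat. \<forall>n\<ge>n\<^sub>0. \<forall>q::nat. q \<ge> 1 \<longrightarrow>
     (real q \<le> real (nat \<lceil>real n / 2\<rceil> choose k) * (ln 2 / ((1 + ln 2) * real n))
        \<longrightarrow> client_has_winning_strategy (complete_edges k n) (NC2 k n) q) \<and>
     (real q \<ge> real k ^ 3 * 2 powr (- real k + 5) * real (n choose k) / real n
        \<longrightarrow> waiter_has_winning_strategy (complete_edges k n) (NC2 k n) q)"
  \<comment> \<open>The lemmas cover every \<open>n\<close>, so \<open>0\<close> is a valid witness
    for \<open>n\<^sub>0\<close>.\<close>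
  using assms client_wins_non_2_colourability waiter_wins_non_2_colourability pair_offer_fits
  by blast

end
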